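(* If $d \geqslant 2$, then $$\sum_{i=1}^d(|\Sigma_i|-1)\leqslant p.$$ In addition, $\sum_{i=1}^d(|\Sigma_i|-1)=p$ implies $\sum_{i=1}^d\lambda_i(|\Sigma_i|-1)=0$ in $\mathbb{F}_p$.
   Context: Let $p$ be a prime. Let $A=(a_1,\dots,a_\ell)$ and $B=(b_1,\dots,b_\ell)$ be two sequences of $\ell \geqslant 1$ elements in $\mathbb{F}_p$ such that the elements of $A$ are nonzero. For a sequence $C=(c_1,\dots,c_\ell)$, let $\mathcal{S}_C$ denote the set of all $0$-$1$ solutions $(x_1,\dots,x_\ell)\in\{0,1\}^\ell$ to the equation $c_1x_1+\dots+c_\ell x_\ell=0$ over $\mathbb{F}_p$. Assume $\mathcal{S}_A \subset \mathcal{S}_B$. For every $\lambda \in \mathbb{F}_p$, let $I_{\lambda}=\{i \in [1,\ell] : b_i/a_i=\lambda\}$; any $\lambda$ with $I_\lambda\neq\emptyset$ is called a ratio associated with $(A,B)$. Let $\lambda_1,\dots,\lambda_d$ be the pairwise distinct ratios associated with $(A,B)$. For every $i \in [1,d]$, let $S_i=(a_j : j\in I_{\lambda_i})$ and let $\Sigma_i=\Sigma(S_i)$, where for a sequence $S=(s_1,\dots,s_k)$ one writes $\Sigma(S)=\sum_{j=1}^k\{0,s_j\}$ for its set of subsums (Minkowski sum). *)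

theory Defs
  imports "HOL-Library.FuncSet" "HOL-Library.Set_Algebras" "Berlekamp_Zassenhaus.Finite_Field"
begin

text \<open>
  The field with \<open>p\<close> elements is \<open>'p mod_ring\<close> with \<open>'p :: prime_card\<close>, so \<open>p = CARD('p)\<close>.
  A sequence \<open>(c\<^sub>1, \<dots>, c\<^sub>l)\<close> is a function \<open>c\<close> on \<open>nat\<close> of which only the values on \<open>{1..l}\<close> matter;
  a finite subsequence is given by its index set, so multiplicities are kept.
\<close>

text \<open>
  The unknowns take the values \<open>0\<close> and \<open>1\<close> of the field itself; elements of the extensional
  function space \<open>\<rightarrow>\<^sub>E\<close> correspond exactly to \<open>l\<close>-tuples.
\<close>

definition zero_one_solutions :: "nat \<Rightarrow> (nat \<Rightarrow> 'a::field) \<Rightarrow> (nat \<Rightarrow> 'a) set" where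
  "zero_one_solutions l c = {x \<in> {1..l} \<rightarrow>\<^sub>E {0, 1}. (\<Sum>i=1..l. c i * x i) = 0}"

definition ratio_class :: "nat \<Rightarrow> (nat \<Rightarrow> 'a::field) \<Rightarrow> (nat \<Rightarrow> 'a) \<Rightarrow> 'a \<Rightarrow> nat set" where
  "ratio_class l a b r = {i \<in> {1..l}. b i / a i = r}"

definition ratios :: "nat \<Rightarrow> (nat \<Rightarrow> 'a::field) \<Rightarrow> (nat \<Rightarrow> 'a) \<Rightarrow> 'a set" where
  "ratios l a b = {r. ratio_class l a b r \<noteq> {}}"

text \<open>The big sum below is the Minkowski sum of sets from \<open>Set_Algebras\<close>.\<close>

definition subsums :: "(nat \<Rightarrow> 'a::comm_monoid_add) \<Rightarrow> nat set \<Rightarrow> 'a set" where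
  "subsums s J = (\<Sum>j\<in>J. {0, s j})"

end

theory Submission
  imports Defs
begin

text \<open>
  Because \<open>b j = \<lambda>\<^sub>i * a j\<close> on the \<open>i\<close>-th ratio class, every tuple \<open>s \<in> \<Sigma>\<^sub>1 \<times> \<dots> \<times> \<Sigma>\<^sub>d\<close> of sum \<open>0\<close>
  satisfies \<open>\<Sum> \<lambda>\<^sub>i s\<^sub>i = 0\<close>. So the polynomial \<open>((\<Sum> x\<^sub>i) ^ (p - 1) - 1) * (\<Sum> \<lambda>\<^sub>i x\<^sub>i)\<close> of degree
  \<open>p\<close> vanishes on the grid. If subsets \<open>A\<^sub>i \<subseteq> \<Sigma>\<^sub>i\<close> have \<open>|A\<^sub>i| = k\<^sub>i + 1\<close> and \<open>\<Sum> k\<^sub>i = p\<close>, then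
  the coefficient of \<open>\<Prod> x\<^sub>i ^ k\<^sub>i\<close> must vanish (combinatorial Nullstellensatz), which gives
  \<open>\<Sum> \<lambda>\<^sub>i k\<^sub>i = 0\<close>. If \<open>\<Sum> (|\<Sigma>\<^sub>i| - 1) > p\<close>, there are two such \<open>k\<close> differing by moving a unit from
  an index \<open>j\<close> to an index \<open>i\<close>, hence \<open>\<lambda>\<^sub>i = \<lambda>\<^sub>j\<close>, a contradiction.

  The coefficient is extracted by a tensor product of divided differences: a weighted sum over the
  grid whose one-dimensional moments of order \<open>m < k\<^sub>i\<close> are \<open>0\<close> and of order \<open>k\<^sub>i\<close> are \<open>1\<close>.
\<close>

section \<open>Divided differences on a finite set\<close>

text \<open>The functional \<open>\<Sum>x\<in>A. w x * f x\<close> then reads off the coefficient of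
  \<open>x ^ k\<close> from polynomials of degree at most \<open>k\<close>. For
  \<open>card A = Suc k\<close> the weights are forced to be
  \<open>1 / (\<Prod>y\<in>A - {x}. x - y)\<close>.\<close>

definition has_moments :: "'a::field set \<Rightarrow> ('a \<Rightarrow> 'a) \<Rightarrow> nat \<Rightarrow> bool" where
  "has_moments A w k \<longleftrightarrow> (\<forall>m\<le>k. (\<Sum>x\<in>A. w x * x ^ m) = of_bool (m = k))"

lemma ex_has_moments:
  fixes A :: "'a::field set"
  assumes "finite A" "card A = Suc k"
  shows "\<exists>w. has_moments A w k"
  using assms
proof (induction A arbitrary: k rule: finite_induct)
  case empty
  then show ?case by simp
next
  case (insert a A)
  show ?case
  proof (cases k)
    case 0
    with insert have "A = {}" by simp
    then show ?thesis
      using 0 by (intro exI[of _ "\<lambda>_. 1"]) (simp add: has_moments_def)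
  next
    case (Suc k')
    with insert obtain w where w: "has_moments A w k'" by auto
    \<comment> \<open>The usual recursion for divided differences; the weight at \<open>a\<close> is
      chosen to make the moment of order 0 vanish.\<close>
    define w' where
      "w' x = (if x = a then - (\<Sum>y\<in>A. w y / (y - a)) else w x / (x - a))" for x
    define M where "M m = (\<Sum>x\<in>insert a A. w' x * x ^ m)" for m
    have M: "M m = w' a * a ^ m + (\<Sum>x\<in>A. w x / (x - a) * x ^ m)" for m
    proof -
      have "(\<Sum>x\<in>A. w' x * x ^ m) = (\<Sum>x\<in>A. w x / (x - a) * x ^ m)"
        using insert by (intro sum.cong) (auto simp: w'_def)
      then show ?thesis using insert by (simp add: M_def)
    qed
    have M_0: "M 0 = 0"
      unfolding M by (simp add: w'_def)
    \<comment> \<open>Writing \<open>x = a + (x - a)\<close> cancels the denominators. Since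
      \<open>M m = 0\<close> for \<open>m < k\<close>, each moment on \<open>A\<close> reappears one
      order higher.\<close>
    have M_Suc: "M (Suc m) = a * M m + (\<Sum>x\<in>A. w x * x ^ m)" for m
    proof -
      have "w x / (x - a) * x ^ Suc m = a * (w x / (x - a) * x ^ m) + w x * x ^ m"
        if "x \<in> A" for x
      proof -
        have "x - a \<noteq> 0" using that insert by auto
        then show ?thesis by (simp add: field_simps)
      qed
      then have "(\<Sum>x\<in>A. w x / (x - a) * x ^ Suc m) =
          a * (\<Sum>x\<in>A. w x / (x - a) * x ^ m) + (\<Sum>x\<in>A. w x * x ^ m)"
        by (simp add: sum_distrib_left flip: sum.distrib)
      then show ?thesis by (simp add: M algebra_simps)
    qed
    have "M m = of_bool (m = k)" if "m \<le> k" for m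
      using that
    proof (induction m)
      case 0
      then show ?case using M_0 Suc by simp
    next
      case (Suc m)
      then show ?case using w \<open>k = Suc k'\<close> by (simp add: M_Suc has_moments_def)
    qed
    then show ?thesis
      unfolding has_moments_def M_def by blast
  qed
qed

section \<open>Coefficient extraction on grids\<close>

text \<open>Any monomial of total degree at most \<open>\<Sum>i\<in>I. k i\<close> other than
  \<open>\<Prod>i\<in>I. s i ^ k i\<close> has some exponent below \<open>k i\<close>, so product
  weights with the right moments annihilate it.\<close>

definition grid_sum ::
  "'i set \<Rightarrow> ('i \<Rightarrow> 'a::field set) \<Rightarrow> ('i \<Rightarrow> 'a \<Rightarrow> 'a) \<Rightarrow> (('i \<Rightarrow> 'a) \<Rightarrow> 'a) \<Rightarrow> 'a" where
  "grid_sum I A w f = (\<Sum>s\<in>Pi\<^sub>E I A. (\<Prod>i\<in>I. w i (s i)) * f s)"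

lemma grid_sum_sum:
  "grid_sum I A w (\<lambda>s. \<Sum>i\<in>J. c i * f i s) = (\<Sum>i\<in>J. c i * grid_sum I A w (f i))"
  unfolding grid_sum_def sum_distrib_left
  by (subst sum.swap) (simp add: algebra_simps)

lemma grid_sum_insert:
  assumes "finite I" "j \<notin> I"
  shows "grid_sum (insert j I) A w f = (\<Sum>x\<in>A j. w j x * grid_sum I A w (\<lambda>s. f (s(j := x))))"
proof -
  have "grid_sum (insert j I) A w f =
      (\<Sum>(x, s)\<in>A j \<times> Pi\<^sub>E I A. (\<Prod>i\<in>insert j I. w i ((s(j := x)) i)) * f (s(j := x)))"
    unfolding grid_sum_def PiE_insert_eq
    by (subst sum.reindex) (use inj_combinator[OF assms(2)] in \<open>auto simp: case_prod_unfold\<close>)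
  also have "\<dots> = (\<Sum>(x, s)\<in>A j \<times> Pi\<^sub>E I A. w j x * ((\<Prod>i\<in>I. w i (s i)) * f (s(j := x))))"
  proof -
    have "(\<Prod>i\<in>I. w i ((s(j := x)) i)) = (\<Prod>i\<in>I. w i (s i))" for s x
      using assms by (intro prod.cong) auto
    then show ?thesis using assms by (simp add: mult.assoc)
  qed
  finally show ?thesis
    by (simp add: grid_sum_def sum_distrib_left sum.cartesian_product)
qed

text \<open>The binomial theorem separates \<open>s j\<close> from the other variables; the factor
  \<open>s j ^ e\<close> raises the moment order from \<open>m\<close> to
  \<open>m + e\<close>.\<close>

lemma grid_sum_power_sum_insert:
  fixes A :: "'i \<Rightarrow> 'a::field set"
  assumes "finite I" "j \<notin> I"
  shows "grid_sum (insert j I) A w (\<lambda>s. s j ^ e * (\<Sum>i\<in>insert j I. s i) ^ n) =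
    (\<Sum>m\<le>n. of_nat (n choose m) * (\<Sum>x\<in>A j. w j x * x ^ (m + e)) *
      grid_sum I A w (\<lambda>s. (\<Sum>i\<in>I. s i) ^ (n - m)))"
proof -
  have "x ^ e * (\<Sum>i\<in>insert j I. (s(j := x)) i) ^ n =
      (\<Sum>m\<le>n. (of_nat (n choose m) * x ^ (m + e)) * (\<Sum>i\<in>I. s i) ^ (n - m))"
    for s :: "'i \<Rightarrow> 'a" and x
  proof -
    have "(\<Sum>i\<in>I. (s(j := x)) i) = (\<Sum>i\<in>I. s i)"
      using assms by (intro sum.cong) auto
    then show ?thesis
      using assms binomial_ring[of x "\<Sum>i\<in>I. s i" n]
      by (simp add: sum_distrib_left power_add mult_ac)
  qed
  then have "grid_sum (insert j I) A w (\<lambda>s. s j ^ e * (\<Sum>i\<in>insert j I. s i) ^ n) =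
      (\<Sum>x\<in>A j. w j x * (\<Sum>m\<le>n. (of_nat (n choose m) * x ^ (m + e)) *
        grid_sum I A w (\<lambda>s. (\<Sum>i\<in>I. s i) ^ (n - m))))"
    by (simp add: grid_sum_insert[OF assms] grid_sum_sum)
  then show ?thesis
    unfolding sum_distrib_left sum_distrib_right
    by (subst (asm) sum.swap) (simp add: algebra_simps)
qed

text \<open>
  The factorials stay on the left-hand side so that nothing has to be assumed about the
  characteristic; \<open>e = 0\<close> drives the induction, and \<open>e = 1\<close> is the case used for the linear factor.
\<close>

lemma grid_sum_coefficient_insert:
  fixes A :: "'i \<Rightarrow> 'a::field set"
  assumes "finite I" "j \<notin> I" "has_moments (A j) (w j) (k j)"
    and IH: "\<And>n. n \<le> (\<Sum>i\<in>I. k i) \<Longrightarrow>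
      of_nat (\<Prod>i\<in>I. fact (k i)) * grid_sum I A w (\<lambda>s. (\<Sum>i\<in>I. s i) ^ n) =
      (if n = (\<Sum>i\<in>I. k i) then of_nat (fact n) else 0)"
    and "n + e \<le> (\<Sum>i\<in>insert j I. k i)" "e \<le> 1"
  shows "of_nat (\<Prod>i\<in>insert j I. fact (k i)) *
      grid_sum (insert j I) A w (\<lambda>s. s j ^ e * (\<Sum>i\<in>insert j I. s i) ^ n) =
    (if n + e = (\<Sum>i\<in>insert j I. k i) then of_nat (fact n * k j ^ e) else 0)"
proof -
  define K where "K = (\<Sum>i\<in>I. k i)"
  define P :: 'a where "P = of_nat (\<Prod>i\<in>I. fact (k i))"
  have sum_k: "(\<Sum>i\<in>insert j I. k i) = k j + K"
    using assms by (simp add: K_def)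
  \<comment> \<open>Only \<open>m + e = k j\<close> can survive: below it the moment in
    \<open>s j\<close> is 0, above it the remaining exponent \<open>n - m\<close> is less than
    \<open>K\<close>, so \<open>IH\<close> gives 0.\<close>
  have summand: "P * (of_nat (n choose m) * (\<Sum>x\<in>A j. w j x * x ^ (m + e)) *
        grid_sum I A w (\<lambda>s. (\<Sum>i\<in>I. s i) ^ (n - m))) =
      (if m + e = k j \<and> n + e = k j + K then of_nat ((n choose m) * fact (n - m)) else 0)"
    if "m \<le> n" for m
  proof (cases "m + e < k j")
    case True
    then have "(\<Sum>x\<in>A j. w j x * x ^ (m + e)) = 0"
      using assms(3) by (simp add: has_moments_def)
    with True show ?thesis by simp
  next
    case False
    then have "n - m \<le> K" using assms(5) that sum_k by linarith
    then have *: "P * grid_sum I A w (\<lambda>s. (\<Sum>i\<in>I. s i) ^ (n - m)) =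
        (if n - m = K then of_nat (fact (n - m)) else 0)"
      using IH[of "n - m"] by (simp add: P_def K_def)
    show ?thesis
    proof (cases "m + e = k j")
      case True
      then have "(\<Sum>x\<in>A j. w j x * x ^ (m + e)) = 1"
        using assms(3) by (simp add: has_moments_def)
      moreover have "n - m = K \<longleftrightarrow> n + e = k j + K"
        using True that by auto
      ultimately show ?thesis using True * by (auto simp: algebra_simps)
    next
      case False
      then have "n - m \<noteq> K" using \<open>\<not> m + e < k j\<close> assms(5) that sum_k by linarith
      then show ?thesis using False * by (auto simp: algebra_simps)
    qed
  qed
  have "of_nat (\<Prod>i\<in>insert j I. fact (k i)) *
      grid_sum (insert j I) A w (\<lambda>s. s j ^ e * (\<Sum>i\<in>insert j I. s i) ^ n) =
    of_nat (fact (k j)) * (\<Sum>m\<le>n. P * (of_nat (n choose m) * (\<Sum>x\<in>A j. w j x * x ^ (m + e)) *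
      grid_sum I A w (\<lambda>s. (\<Sum>i\<in>I. s i) ^ (n - m))))"
    using assms(1,2)
    by
      (simp add: grid_sum_power_sum_insert P_def mult.assoc del: sum.insert flip: sum_distrib_left)
  also have "\<dots> = of_nat (fact (k j)) * (\<Sum>m\<le>n.
      if m + e = k j \<and> n + e = k j + K then of_nat ((n choose m) * fact (n - m)) else 0)"
    by (intro arg_cong2[of _ _ _ _ "(*)"] sum.cong refl) (simp only: summand atMost_iff)
  also have "\<dots> = (if n + e = k j + K then of_nat (fact n * k j ^ e) else 0)"
  \<comment> \<open>The surviving index is \<open>m = k j - e\<close>. It is missing only for
    \<open>e = 1\<close> and \<open>k j = 0\<close>, where the factor \<open>k j ^ e\<close> is 0 as
    well.\<close>
  proof (cases "n + e = k j + K \<and> e \<le> k j")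
    case True
    then have "k j - e \<le> n" by linarith
    have "m + e = k j \<longleftrightarrow> m = k j - e" for m using True by auto
    then have "of_nat (fact (k j)) * (\<Sum>m\<le>n.
        if m + e = k j \<and> n + e = k j + K then of_nat ((n choose m) * fact (n - m)) else 0) =
        (of_nat (fact (k j) * ((n choose (k j - e)) * fact (n - (k j - e)))) :: 'a)"
      using True \<open>k j - e \<le> n\<close> by simp
    moreover have "fact (k j) * ((n choose (k j - e)) * fact (n - (k j - e))) = fact n * k j ^ e"
    proof -
      have "fact (k j) = k j ^ e * fact (k j - e)"
        using \<open>e \<le> 1\<close> True by (cases "k j"; cases e) auto
      then show ?thesis
        using binomial_fact_lemma[OF \<open>k j - e \<le> n\<close>] by (simp add: algebra_simps)
    qed
    ultimately show ?thesis using True by (simp only: simp_thms if_True)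
  next
    case False
    show ?thesis
    proof (cases "n + e = k j + K")
      case True
      then have "e = 1" "k j = 0" using False \<open>e \<le> 1\<close> by auto
      then show ?thesis by simp
    qed (use False in simp)
  qed
  finally show ?thesis by (simp only: sum_k)
qed

text \<open>This is the multinomial coefficient with its denominators cleared.\<close>

lemma grid_sum_power_sum:
  assumes "finite I" "\<And>i. i \<in> I \<Longrightarrow> has_moments (A i) (w i) (k i)" "n \<le> (\<Sum>i\<in>I. k i)"
  shows "of_nat (\<Prod>i\<in>I. fact (k i)) * grid_sum I A w (\<lambda>s. (\<Sum>i\<in>I. s i) ^ n) =
    (if n = (\<Sum>i\<in>I. k i) then of_nat (fact n) else 0)"
  using assms
proof (induction I arbitrary: n rule: finite_induct)
  case empty
  then show ?case by (simp add: grid_sum_def)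
next
  case (insert j I)
  then show ?case
    using grid_sum_coefficient_insert[of I j A w k n 0] by simp
qed

text \<open>The multinomial coefficient with \<open>k j\<close> lowered by one, since one factor
  \<open>s j\<close> is already supplied; peeling off \<open>j\<close> last reduces it to
  \<open>e = 1\<close>.\<close>

lemma grid_sum_times_power_sum:
  assumes "finite I" "j \<in> I" "\<And>i. i \<in> I \<Longrightarrow> has_moments (A i) (w i) (k i)"
    and "Suc n \<le> (\<Sum>i\<in>I. k i)"
  shows "of_nat (\<Prod>i\<in>I. fact (k i)) * grid_sum I A w (\<lambda>s. s j * (\<Sum>i\<in>I. s i) ^ n) =
    (if Suc n = (\<Sum>i\<in>I. k i) then of_nat (fact n * k j) else 0)"
proof -
  have "insert j (I - {j}) = I" using assms by auto
  then show ?thesis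
    using grid_sum_coefficient_insert[of "I - {j}" j A w k n 1]
      grid_sum_power_sum[of "I - {j}" A w k] assms by simp
qed

section \<open>A Nullstellensatz relation modulo \<open>p\<close>\<close>

lemma fermat_mod_ring:
  fixes x :: "'p::prime_card mod_ring"
  assumes "x \<noteq> 0"
  shows "x ^ (CARD('p) - 1) = 1"
proof -
  have "CARD('p) \<ge> 2" using prime_card[where 'a = 'p] prime_ge_2_nat by blast
  \<comment> \<open>This exposes the exponent by which \<open>inverse\<close> is defined on
    \<open>mod_ring\<close>.\<close>
  then have "CARD('p) - 1 = Suc (nat (int CARD('p) - 2))" by (simp add: nat_diff_distrib)
  then have "x ^ (CARD('p) - 1) = x * inverse x"
    using assms by (simp add: inverse_mod_ring_def)
  then show ?thesis using assms by simp
qed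

lemma sum_weighted_degrees_eq_0:
  fixes A :: "'i \<Rightarrow> 'p::prime_card mod_ring set"
  assumes "finite I" "\<And>i. i \<in> I \<Longrightarrow> card (A i) = Suc (k i)" "(\<Sum>i\<in>I. k i) = CARD('p)"
    and zero: "\<And>s. s \<in> Pi\<^sub>E I A \<Longrightarrow> (\<Sum>i\<in>I. s i) = 0 \<Longrightarrow> (\<Sum>i\<in>I. c i * s i) = 0"
  shows "(\<Sum>i\<in>I. c i * of_nat (k i)) = 0"
proof -
  have prime: "prime CARD('p)" by (rule prime_card)
  then have p2: "CARD('p) \<ge> 2" by (rule prime_ge_2_nat)
  have "\<exists>w. has_moments (A i) w (k i)" if "i \<in> I" for i
    using assms(2)[OF that] by (intro ex_has_moments) (auto intro: card_ge_0_finite)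
  then obtain w where w: "\<And>i. i \<in> I \<Longrightarrow> has_moments (A i) (w i) (k i)" by metis
  define P :: "'p mod_ring" where "P = of_nat (\<Prod>i\<in>I. fact (k i))"
  have expand: "P * grid_sum I A w (\<lambda>s. (\<Sum>i\<in>I. c i * s i) * (\<Sum>i\<in>I. s i) ^ n) =
      (\<Sum>i\<in>I. c i * (if Suc n = CARD('p) then of_nat (fact n * k i) else 0))"
    if "Suc n \<le> CARD('p)" for n
  proof -
    have "P * grid_sum I A w (\<lambda>s. (\<Sum>i\<in>I. c i * s i) * (\<Sum>i\<in>I. s i) ^ n) =
        P * (\<Sum>i\<in>I. c i * grid_sum I A w (\<lambda>s. s i * (\<Sum>i\<in>I. s i) ^ n))"
      by (simp add: sum_distrib_right mult.assoc grid_sum_sum)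
    also have "\<dots> = (\<Sum>i\<in>I. c i * (P * grid_sum I A w (\<lambda>s. s i * (\<Sum>i\<in>I. s i) ^ n)))"
      by (simp add: sum_distrib_left mult.left_commute)
    also have "\<dots> = (\<Sum>i\<in>I. c i * (if Suc n = CARD('p) then of_nat (fact n * k i) else 0))"
      using grid_sum_times_power_sum[OF assms(1) _ w, where n = n] that assms(3)
      by (intro sum.cong) (auto simp: P_def)
    finally show ?thesis .
  qed
  \<comment> \<open>On the grid, either the sum of the coordinates is 0 and \<open>zero\<close>
    kills the linear factor, or its power is 1 by Fermat.\<close>
  have "grid_sum I A w (\<lambda>s. (\<Sum>i\<in>I. c i * s i) * (\<Sum>i\<in>I. s i) ^ (CARD('p) - 1)) =
      grid_sum I A w (\<lambda>s. (\<Sum>i\<in>I. c i * s i) * (\<Sum>i\<in>I. s i) ^ 0)"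
    unfolding grid_sum_def
  proof (intro sum.cong refl)
    fix s assume "s \<in> Pi\<^sub>E I A"
    then have "(\<Sum>i\<in>I. c i * s i) * (\<Sum>i\<in>I. s i) ^ (CARD('p) - 1) =
        (\<Sum>i\<in>I. c i * s i) * (\<Sum>i\<in>I. s i) ^ 0"
      using zero[of s] by (cases "(\<Sum>i\<in>I. s i) = 0") (simp_all add: fermat_mod_ring[simplified])
    then show "(\<Prod>i\<in>I. w i (s i)) * ((\<Sum>i\<in>I. c i * s i) * (\<Sum>i\<in>I. s i) ^ (CARD('p) - 1)) =
        (\<Prod>i\<in>I. w i (s i)) * ((\<Sum>i\<in>I. c i * s i) * (\<Sum>i\<in>I. s i) ^ 0)"
      by simp
  qed
  \<comment> \<open>With exponent 0 the degree is 1, below \<open>p\<close>, so that side vanishes;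
    the other side is the coefficient in degree exactly \<open>p\<close>.\<close>
  then have "(\<Sum>i\<in>I. c i * of_nat (fact (CARD('p) - 1) * k i)) = 0"
    using expand[of "CARD('p) - 1"] expand[of 0] p2 by simp
  then have "of_nat (fact (CARD('p) - 1)) * (\<Sum>i\<in>I. c i * of_nat (k i)) = 0"
    by (simp add: sum_distrib_left mult.left_commute)
  moreover have "of_nat (fact (CARD('p) - 1)) \<noteq> (0 :: 'p mod_ring)"
    using of_nat_0_mod_ring_dvd[where 'a = 'p, of "fact (CARD('p) - 1)"] prime_dvd_fact_iff[OF prime] p2
    by auto
  ultimately show ?thesis by simp
qed

section \<open>Bounding the total degree\<close>

lemma ex_sum_eq_le:
  fixes k :: "'i \<Rightarrow> nat"
  assumes "finite I" "n \<le> (\<Sum>i\<in>I. k i)"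
  shows "\<exists>k'. (\<forall>i. k' i \<le> k i) \<and> (\<Sum>i\<in>I. k' i) = n"
  using assms
proof (induction I arbitrary: n rule: finite_induct)
  case empty
  then show ?case by (intro exI[of _ "\<lambda>_. 0"]) simp
next
  case (insert j I)
  have "n - min n (k j) \<le> (\<Sum>i\<in>I. k i)" using insert by auto
  with insert obtain k' where k': "\<forall>i. k' i \<le> k i" "(\<Sum>i\<in>I. k' i) = n - min n (k j)" by blast
  have "(\<Sum>i\<in>I. (k'(j := min n (k j))) i) = (\<Sum>i\<in>I. k' i)"
    using insert by (intro sum.cong) auto
  then show ?case
    using insert k' by (intro exI[of _ "k'(j := min n (k j))"]) auto
qed

lemma sum_degrees_le_CARD:
  fixes A :: "'i \<Rightarrow> 'p::prime_card mod_ring set"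
  assumes "finite I" "\<And>i. i \<in> I \<Longrightarrow> card (A i) = Suc (k i)" "inj_on c I"
    and zero: "\<And>s. s \<in> Pi\<^sub>E I A \<Longrightarrow> (\<Sum>i\<in>I. s i) = 0 \<Longrightarrow> (\<Sum>i\<in>I. c i * s i) = 0"
  shows "(\<Sum>i\<in>I. k i) \<le> CARD('p)"
proof (rule ccontr)
  assume "\<not> ?thesis"
  then have gt: "CARD('p) < (\<Sum>i\<in>I. k i)" by simp
  \<comment> \<open>Shrinking each \<open>A i\<close> to \<open>Suc (k' i)\<close> elements
    preserves \<open>zero\<close>, so every degree vector below \<open>k\<close> of sum
    \<open>p\<close> yields a relation.\<close>
  have sub: "(\<Sum>i\<in>I. c i * of_nat (k' i)) = 0"
    if k': "\<And>i. i \<in> I \<Longrightarrow> k' i \<le> k i" "(\<Sum>i\<in>I. k' i) = CARD('p)" for k'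
  proof -
    have "\<exists>B. B \<subseteq> A i \<and> card B = Suc (k' i)" if "i \<in> I" for i
      using assms(2)[OF that] k'(1)[OF that] obtain_subset_with_card_n[of "Suc (k' i)" "A i"]
      by (metis Suc_le_mono)
    then obtain B where B: "\<And>i. i \<in> I \<Longrightarrow> B i \<subseteq> A i \<and> card (B i) = Suc (k' i)" by metis
    then have "Pi\<^sub>E I B \<subseteq> Pi\<^sub>E I A" by (intro PiE_mono) auto
    with B k'(2) zero show ?thesis
      by (intro sum_weighted_degrees_eq_0[OF assms(1), of B]) auto
  qed
  obtain k' where k': "\<And>i. k' i \<le> k i" "(\<Sum>i\<in>I. k' i) = CARD('p)"
    using ex_sum_eq_le[OF assms(1), of "CARD('p)" k] gt by auto
  have "\<exists>i\<in>I. k' i < k i"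
  proof (rule ccontr)
    assume "\<not> ?thesis"
    then have "(\<Sum>i\<in>I. k i) \<le> (\<Sum>i\<in>I. k' i)" by (intro sum_mono) (simp add: not_less)
    with gt k' show False by simp
  qed
  then obtain i where i: "i \<in> I" "k' i < k i" by blast
  \<comment> \<open>Hence \<open>k i \<le> p - 1\<close>: the index \<open>i\<close> alone cannot
    carry the whole sum \<open>p\<close>, and another index has a unit to give away.\<close>
  have "card (A i) \<le> CARD('p)"
    using card_mono[of UNIV "A i"] by simp
  with i assms(2) have "k' i < CARD('p)" by fastforce
  then have "(\<Sum>j\<in>I - {i}. k' j) \<noteq> 0"
    using k'(2) sum.remove[OF assms(1) i(1), of k'] by linarith
  then obtain j where "j \<in> I - {i}" "k' j \<noteq> 0"
    by (rule sum.not_neutral_contains_not_neutral)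
  then have j: "j \<in> I" "j \<noteq> i" "k' j > 0"
    by auto
  define k'' where "k'' = k'(i := k' i + 1, j := k' j - 1)"
  have split: "(\<Sum>x\<in>I. f x) = f i + (f j + (\<Sum>x\<in>I - {i} - {j}. f x))"
    for f :: "'i \<Rightarrow> 'b::comm_monoid_add"
    using assms(1) i j by (simp add: sum.remove[of I i] sum.remove[of "I - {i}" j])
  have rest: "(\<Sum>x\<in>I - {i} - {j}. f x (k'' x)) = (\<Sum>x\<in>I - {i} - {j}. f x (k' x))"
    for f :: "'i \<Rightarrow> nat \<Rightarrow> 'b::comm_monoid_add"
    by (intro sum.cong) (auto simp: k''_def)
  have k''_ij: "k'' i = k' i + 1" "k' j = k'' j + 1"
    using j by (auto simp: k''_def)
  have "(\<Sum>x\<in>I. k'' x) = CARD('p)"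
    using k'(2) rest[of "\<lambda>_ y. y"] k''_ij unfolding split by simp
  moreover have "k'' x \<le> k x" for x
    using k'(1)[of x] i by (auto simp: k''_def)
  ultimately have "(\<Sum>x\<in>I. c x * of_nat (k'' x)) = 0" by (intro sub)
  then have "c i * (of_nat (k' i) + 1) + (c j * of_nat (k'' j) +
      (\<Sum>x\<in>I - {i} - {j}. c x * of_nat (k' x))) = 0" (is "?u = 0")
    using rest[of "\<lambda>x y. c x * of_nat y"] k''_ij(1) split[of "\<lambda>x. c x * of_nat (k'' x)"]
    by (simp add: add.commute)
  moreover have "(\<Sum>x\<in>I. c x * of_nat (k' x)) = 0" using k' by (intro sub)
  then have "c i * of_nat (k' i) + (c j * (of_nat (k'' j) + 1) +
      (\<Sum>x\<in>I - {i} - {j}. c x * of_nat (k' x))) = 0" (is "?v = 0")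
    using k''_ij(2) split[of "\<lambda>x. c x * of_nat (k' x)"] by (simp add: add.commute)
  \<comment> \<open>The two relations differ only in the unit moved from \<open>j\<close> to
    \<open>i\<close>.\<close>
  moreover have "c i - c j = ?u - ?v" by (simp add: algebra_simps)
  ultimately have "c i = c j" by simp
  with assms(3) i j show False by (auto dest: inj_onD)
qed

section \<open>Subsums and ratio classes\<close>

lemma mem_subsumsE:
  fixes a :: "nat \<Rightarrow> 'a::semiring_1"
  assumes "finite J" "s \<in> subsums a J"
  obtains x where "x \<in> J \<rightarrow> {0, 1}" "s = (\<Sum>j\<in>J. a j * x j)"
proof -
  obtain t where t: "\<forall>j\<in>J. t j \<in> {0, a j}" "s = sum t J"
    using assms by (auto simp: subsums_def set_sum_alt)
  define x where "x j = (if t j = 0 then 0 else 1 :: 'a)" for j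
  have "sum t J = (\<Sum>j\<in>J. a j * x j)"
    using t by (intro sum.cong) (auto simp: x_def)
  with t that[of x] show ?thesis by (auto simp: x_def)
qed

lemma finite_subsums:
  "finite J \<Longrightarrow> finite (subsums a J)"
  unfolding subsums_def by (induction J rule: finite_induct) (auto intro: finite_set_plus)

lemma zero_mem_subsums:
  assumes "finite J"
  shows "0 \<in> subsums a J"
proof -
  have "(\<Sum>j\<in>J. 0) \<in> subsums a J"
    unfolding subsums_def set_sum_alt[OF assms] by (intro CollectI exI conjI) auto
  then show ?thesis by simp
qed

text \<open>The classes cover \<open>{1..l}\<close> because \<open>lam\<close> reaches every ratio,
  and are disjoint because \<open>lam\<close> is injective.\<close>

lemma sum_ratio_classes:
  assumes "finite I" "bij_betw lam I (ratios l a b)"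
  shows "(\<Sum>j=1..l. f j) = (\<Sum>i\<in>I. \<Sum>j\<in>ratio_class l a b (lam i). f j)"
proof -
  have "{1..l} = (\<Union>i\<in>I. ratio_class l a b (lam i))"
    using assms(2) by (auto simp: bij_betw_def ratios_def ratio_class_def) blast
  then show ?thesis
    using assms
    by (simp add: sum.UNION_disjoint)
       (subst sum.UNION_disjoint; auto simp: ratio_class_def bij_betw_def dest: inj_onD)
qed

text \<open>The 0-1 coefficients of the \<open>s i\<close> glue, along the partition into classes,
  to one solution for \<open>a\<close>. It is then a solution for \<open>b\<close>, and
  \<open>b j = lam i * a j\<close> on the class of \<open>lam i\<close>.\<close>

lemma subsums_relation_transfer:
  fixes a b :: "nat \<Rightarrow> 'a::field"
  assumes "finite I" "bij_betw lam I (ratios l a b)"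
    and "\<And>j. j \<in> {1..l} \<Longrightarrow> a j \<noteq> 0"
    and "zero_one_solutions l a \<subseteq> zero_one_solutions l b"
    and s: "\<And>i. i \<in> I \<Longrightarrow> s i \<in> subsums a (ratio_class l a b (lam i))"
    and "(\<Sum>i\<in>I. s i) = 0"
  shows "(\<Sum>i\<in>I. lam i * s i) = 0"
proof -
  have "\<exists>x. x \<in> ratio_class l a b (lam i) \<rightarrow> {0, 1} \<and>
      s i = (\<Sum>j\<in>ratio_class l a b (lam i). a j * x j)" if "i \<in> I" for i
  proof -
    have "finite (ratio_class l a b (lam i))" by (simp add: ratio_class_def)
    then show ?thesis by (rule mem_subsumsE[OF _ s[OF that]]) blast
  qed
  then obtain x where x: "\<And>i. i \<in> I \<Longrightarrow> x i \<in> ratio_class l a b (lam i) \<rightarrow> {0, 1}"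
      "\<And>i. i \<in> I \<Longrightarrow> s i = (\<Sum>j\<in>ratio_class l a b (lam i). a j * x i j)"
    by metis
  \<comment> \<open>\<open>g j\<close> is the index of the class containing
    \<open>j\<close>.\<close>
  define g where "g j = inv_into I lam (b j / a j)" for j
  have g: "g j = i" if "i \<in> I" "j \<in> ratio_class l a b (lam i)" for i j
    using that assms(2) by (simp add: g_def ratio_class_def bij_betw_def)
  have g': "g j \<in> I \<and> j \<in> ratio_class l a b (lam (g j))" if "j \<in> {1..l}" for j
  proof -
    have "b j / a j \<in> lam ` I"
      using that assms(2) by (auto simp: bij_betw_def ratios_def ratio_class_def)
    then show ?thesis
      using that by (auto simp: g_def ratio_class_def inv_into_into f_inv_into_f)
  qed
  define y where "y = restrict (\<lambda>j. x (g j) j) {1..l}"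
  have y: "y j = x i j" if "i \<in> I" "j \<in> ratio_class l a b (lam i)" for i j
    using that g[OF that] by (auto simp: y_def ratio_class_def)
  have "(\<Sum>j=1..l. a j * y j) = (\<Sum>i\<in>I. s i)"
    unfolding sum_ratio_classes[OF assms(1,2)] using x(2) y by (auto intro!: sum.cong)
  moreover have "y \<in> {1..l} \<rightarrow>\<^sub>E {0, 1}"
    using x(1) g' by (fastforce simp: y_def)
  ultimately have "y \<in> zero_one_solutions l b"
    using assms(4,6) by (auto simp: zero_one_solutions_def)
  then have "0 = (\<Sum>j=1..l. b j * y j)"
    by (simp add: zero_one_solutions_def)
  also have "\<dots> = (\<Sum>i\<in>I. \<Sum>j\<in>ratio_class l a b (lam i). lam i * (a j * x i j))"
    unfolding sum_ratio_classes[OF assms(1,2)]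
  proof (intro sum.cong refl)
    fix i j assume ij: "i \<in> I" "j \<in> ratio_class l a b (lam i)"
    then have "a j \<noteq> 0" "lam i = b j / a j"
      using assms(3)[of j] by (auto simp: ratio_class_def)
    then have "b j = lam i * a j" by simp
    then show "b j * y j = lam i * (a j * x i j)"
      using y[OF ij] by simp
  qed
  also have "\<dots> = (\<Sum>i\<in>I. lam i * s i)"
    using x(2) by (simp add: sum_distrib_left)
  finally show ?thesis by simp
qed

theorem theorem3p2:
  fixes a b :: "nat \<Rightarrow> 'p::prime_card mod_ring"
    and l d :: nat
    and lam :: "nat \<Rightarrow> 'p mod_ring"
    and Sig :: "nat \<Rightarrow> 'p mod_ring set"
  assumes "l \<ge> 1"
    and "\<And>i. i \<in> {1..l} \<Longrightarrow> a i \<noteq> 0"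
    and "zero_one_solutions l a \<subseteq> zero_one_solutions l b"
    and "bij_betw lam {1..d} (ratios l a b)"
    and "\<And>i. i \<in> {1..d} \<Longrightarrow> Sig i = subsums a (ratio_class l a b (lam i))"
    and "d \<ge> 2"
  shows "(\<Sum>i=1..d. (int (card (Sig i)) - 1)) \<le> int CARD('p) \<and>
    ((\<Sum>i=1..d. (int (card (Sig i)) - 1)) = int CARD('p) \<longrightarrow>
      (\<Sum>i=1..d. lam i * (of_nat (card (Sig i)) - 1)) = 0)"
proof -
  \<comment> \<open>Since 0 is a subsum, the cardinality is positive and the natural subtraction is
    not truncated.\<close>
  define k where "k i = card (Sig i) - 1" for i
  have card: "card (Sig i) = Suc (k i)" if "i \<in> {1..d}" for i
  proof -
    have "finite (ratio_class l a b (lam i))" by (simp add: ratio_class_def)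
    then have "card (Sig i) > 0"
      using finite_subsums zero_mem_subsums assms(5)[OF that] by (metis card_gt_0_iff empty_iff)
    then show ?thesis by (simp add: k_def)
  qed
  have zero: "(\<Sum>i=1..d. lam i * s i) = 0"
    if "s \<in> Pi\<^sub>E {1..d} Sig" "(\<Sum>i=1..d. s i) = 0" for s
  proof (rule subsums_relation_transfer[OF _ assms(4,2,3) _ that(2)])
    show "s i \<in> subsums a (ratio_class l a b (lam i))" if "i \<in> {1..d}" for i
      using PiE_mem[OF \<open>s \<in> Pi\<^sub>E {1..d} Sig\<close> that] assms(5)[OF that] by simp
  qed auto
  have sum_int: "(\<Sum>i=1..d. (int (card (Sig i)) - 1)) = int (\<Sum>i=1..d. k i)"
    unfolding of_nat_sum by (intro sum.cong) (simp_all add: card)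
  have sum_lam: "(\<Sum>i=1..d. lam i * (of_nat (card (Sig i)) - 1)) = (\<Sum>i=1..d. lam i * of_nat (k i))"
    by (intro sum.cong) (simp_all add: card)
  have "inj_on lam {1..d}" using assms(4) by (rule bij_betw_imp_inj_on)
  then have "(\<Sum>i=1..d. k i) \<le> CARD('p)"
    by (intro sum_degrees_le_CARD[OF _ card _ zero]) auto
  \<comment> \<open>In the extremal case the full sets \<open>Sig i\<close> already form a grid of
    total degree \<open>p\<close>.\<close>
  moreover have "(\<Sum>i=1..d. lam i * of_nat (k i)) = 0" if "(\<Sum>i=1..d. k i) = CARD('p)"
    using that by (intro sum_weighted_degrees_eq_0[OF _ card _ zero]) auto
  ultimately show ?thesis
    unfolding sum_int sum_lam of_nat_le_iff of_nat_eq_iff by blast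
qed

end
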